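(* Let $F=(F_1,\dots,F_m):\mathbb{R}^n\to\mathbb{R}^m$ and $x^0\in\mathbb{R}^n$ satisfy the following assumptions: (i) $F$ is continuously differentiable; (ii) the level set $\mathcal{L}:=\{x\in\mathbb{R}^n : F_j(x)\le F_j(x^0)\ \forall j=1,\dots,m\}$ is bounded; (iii) there exist an open set $\mathcal{N}\supset\mathcal{L}$ and $L>0$ such that $\|\nabla F_j(x)-\nabla F_j(y)\|\le L\|x-y\|$ for all $x,y\in\mathcal{N}$ and all $j=1,\dots,m$. Let $\{x^k\}$ be an infinite sequence generated by the BFGS-type Algorithm described in the context, started at $x^0$, with no $x^k$ Pareto critical. Then $$\liminf_{k\to\infty}\|d_{SD}(x^k)\|=0.$$ As a consequence, $\{x^k\}$ has a limit point that is Pareto critical.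
   Context: Notation. $\|\cdot\|$ is the Euclidean norm; $\Delta_m:=\{\lambda\in\mathbb{R}^m:\lambda_j\ge 0\ \forall j,\ \sum_{j=1}^m\lambda_j=1\}$; $B\succ0$ means symmetric positive definite. For a continuously differentiable $F=(F_1,\dots,F_m):\mathbb{R}^n\to\mathbb{R}^m$ put $\mathcal{D}(x,d):=\max_{j=1,\dots,m}\nabla F_j(x)^\top d$. A point $x$ is Pareto critical if there is no $d\in\mathbb{R}^n$ with $\nabla F_j(x)^\top d<0$ for all $j=1,\dots,m$. The steepest descent direction $d_{SD}(x)$ is the unique minimizer over $d\in\mathbb{R}^n$ of $\max_{j=1,\dots,m}\nabla F_j(x)^\top d+\tfrac12\|d\|^2$. Algorithm. Data: $\rho\in(0,1/2)$, $\sigma\in(\rho,1)$, $0<\underline{\vartheta}\le\bar{\vartheta}$, $x^0\in\mathbb{R}^n$, and matrices $B_j^0\succ0$ in $\mathbb{R}^{n\times n}$, $j=1,\dots,m$. For $k=0,1,2,\dots$: Step 1: let $d^k$ be the unique minimizer over $d\in\mathbb{R}^n$ of $\max_{j=1,\dots,m}\nabla F_j(x^k)^\top d+\tfrac12 d^\top B_j^k d$. Step 2: if $x^k$ is Pareto critical, stop. Step 3: compute a step size $\alpha_k>0$ (trying first $\alpha_k=1$, i.e. $\alpha_k=1$ is taken whenever it satisfies both conditions) such that $F_j(x^k+\alpha_kd^k)\le F_j(x^k)+\rho\alpha_k\mathcal{D}(x^k,d^k)$ for all $j=1,\dots,m$, and $\mathcal{D}(x^k+\alpha_kd^k,d^k)\ge\sigma\mathcal{D}(x^k,d^k)$;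 set $x^{k+1}:=x^k+\alpha_kd^k$. Step 4: set $s^k:=x^{k+1}-x^k$, $y_j^k:=\nabla F_j(x^{k+1})-\nabla F_j(x^k)$, $\eta_j^k:=(y_j^k)^\top s^k/\|s^k\|^2$; choose arbitrary $\mu^k\in\Delta_m$ and $\vartheta_k\in[\underline{\vartheta},\bar{\vartheta}]$; set $r_j^k:=\max\{-\eta_j^k,0\}+\vartheta_k\big\|\sum_{i=1}^m\mu_i^k\nabla F_i(x^k)\big\|$ and $\gamma_j^k:=y_j^k+r_j^ks^k$ for $j=1,\dots,m$. Step 5: for $j=1,\dots,m$ set $B_j^{k+1}:=B_j^k-\dfrac{B_j^ks^k(s^k)^\top B_j^k}{(s^k)^\top B_j^ks^k}+\dfrac{\gamma_j^k(\gamma_j^k)^\top}{(\gamma_j^k)^\top s^k}$. *)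

theory Defs
  imports "HOL-Analysis.Analysis"
begin

definition gradient :: "('a::real_inner \<Rightarrow> real) \<Rightarrow> 'a \<Rightarrow> 'a"
  where "gradient f x = (THE g. GDERIV f x :> g)"

definition comp_grad :: "(real^'n \<Rightarrow> real^'m) \<Rightarrow> 'm \<Rightarrow> real^'n \<Rightarrow> real^'n"
  where "comp_grad F j x = gradient (\<lambda>z. F z $ j) x"

definition continuously_differentiable :: "(real^'n \<Rightarrow> real^'m) \<Rightarrow> bool"
  where "continuously_differentiable F \<longleftrightarrow>
    (\<forall>x. F differentiable (at x)) \<and> (\<forall>j. continuous_on UNIV (comp_grad F j))"

definition level_set :: "(real^'n \<Rightarrow> real^'m) \<Rightarrow> real^'n \<Rightarrow> (real^'n) set"
  where "level_set F x0 = {x. \<forall>j. F x $ j \<le> F x0 $ j}"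

definition max_dir_deriv :: "(real^'n \<Rightarrow> real^'m) \<Rightarrow> real^'n \<Rightarrow> real^'n \<Rightarrow> real"
  where "max_dir_deriv F x d = Max (range (\<lambda>j. comp_grad F j x \<bullet> d))"

definition pareto_critical :: "(real^'n \<Rightarrow> real^'m) \<Rightarrow> real^'n \<Rightarrow> bool"
  where "pareto_critical F x \<longleftrightarrow> \<not> (\<exists>d. \<forall>j. comp_grad F j x \<bullet> d < 0)"

(* The objective is strongly convex, so the minimizer exists and is unique. *)
definition steepest_descent_dir :: "(real^'n \<Rightarrow> real^'m) \<Rightarrow> real^'n \<Rightarrow> real^'n"
  where "steepest_descent_dir F x =
    (THE d. is_arg_min (\<lambda>d. max_dir_deriv F x d + (1/2) * (norm d)\<^sup>2) (\<lambda>_. True) d)"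

definition unit_simplex :: "(real^'m) set"
  where "unit_simplex = {l. (\<forall>j. 0 \<le> l $ j) \<and> (\<Sum>j\<in>UNIV. l $ j) = 1}"

definition sym_pos_def :: "real^'n^'n \<Rightarrow> bool"
  where "sym_pos_def A \<longleftrightarrow> transpose A = A \<and> (\<forall>v. v \<noteq> 0 \<longrightarrow> 0 < v \<bullet> (A *v v))"

definition outer_prod :: "real^'n \<Rightarrow> real^'n \<Rightarrow> real^'n^'n"
  where "outer_prod v w = (\<chi> i j. v $ i * w $ j)"

(* max_j (grad F_j(x) . d + d . B_j d / 2): the maximum also ranges over the matrices B_j. *)
definition qn_model ::
  "(real^'n \<Rightarrow> real^'m) \<Rightarrow> real^'n \<Rightarrow> ('m \<Rightarrow> real^'n^'n) \<Rightarrow> real^'n \<Rightarrow> real"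
  where "qn_model F x B d = Max (range (\<lambda>j. comp_grad F j x \<bullet> d + (1/2) * (d \<bullet> (B j *v d))))"

definition wolfe_step ::
  "(real^'n \<Rightarrow> real^'m) \<Rightarrow> real \<Rightarrow> real \<Rightarrow> real^'n \<Rightarrow> real^'n \<Rightarrow> real \<Rightarrow> bool"
  where "wolfe_step F \<rho> \<sigma> x d \<alpha> \<longleftrightarrow>
    0 < \<alpha> \<and>
    (\<forall>j. F (x + \<alpha> *\<^sub>R d) $ j \<le> F x $ j + \<rho> * \<alpha> * max_dir_deriv F x d) \<and>
    max_dir_deriv F (x + \<alpha> *\<^sub>R d) d \<ge> \<sigma> * max_dir_deriv F x d"

(* The vector gamma_j of Step 4, for consecutive iterates x and x'. *)
definition gamma_vec ::
  "(real^'n \<Rightarrow> real^'m) \<Rightarrow> real^'n \<Rightarrow> real^'n \<Rightarrow> real^'m \<Rightarrow> real \<Rightarrow> 'm \<Rightarrow> real^'n"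
  where "gamma_vec F x x' \<mu> \<theta> j =
    (let s = x' - x;
         y = comp_grad F j x' - comp_grad F j x;
         \<eta> = (y \<bullet> s) / (norm s)\<^sup>2;
         r = max (- \<eta>) 0 + \<theta> * norm (\<Sum>i\<in>UNIV. \<mu> $ i *\<^sub>R comp_grad F i x)
     in y + r *\<^sub>R s)"

definition bfgs_update :: "real^'n^'n \<Rightarrow> real^'n \<Rightarrow> real^'n \<Rightarrow> real^'n^'n"
  where "bfgs_update B s \<gamma> =
    B - (B ** outer_prod s s ** B) /\<^sub>R (s \<bullet> (B *v s)) + outer_prod \<gamma> \<gamma> /\<^sub>R (\<gamma> \<bullet> s)"

(* An infinite run: the stopping test of Step 2 (x k Pareto critical) is not part of this
   predicate, so the assumption that it never succeeds has to be made separately.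
   In Step 1 positive definiteness of the matrices makes the minimizer unique. *)
definition bfgs_run ::
  "(real^'n \<Rightarrow> real^'m) \<Rightarrow> real \<Rightarrow> real \<Rightarrow> real \<Rightarrow> real \<Rightarrow> real^'n \<Rightarrow>
   (nat \<Rightarrow> real^'n) \<Rightarrow> (nat \<Rightarrow> 'm \<Rightarrow> real^'n^'n) \<Rightarrow> (nat \<Rightarrow> real^'n) \<Rightarrow> (nat \<Rightarrow> real) \<Rightarrow>
   (nat \<Rightarrow> real^'m) \<Rightarrow> (nat \<Rightarrow> real) \<Rightarrow> bool"
  where "bfgs_run F \<rho> \<sigma> \<theta>lo \<theta>hi x0 x B d \<alpha> \<mu> \<theta> \<longleftrightarrow>
    x 0 = x0 \<and>
    (\<forall>j. sym_pos_def (B 0 j)) \<and>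
    (\<forall>k.
      is_arg_min (qn_model F (x k) (B k)) (\<lambda>_. True) (d k) \<and>
      wolfe_step F \<rho> \<sigma> (x k) (d k) (\<alpha> k) \<and>
      (wolfe_step F \<rho> \<sigma> (x k) (d k) 1 \<longrightarrow> \<alpha> k = 1) \<and>
      x (Suc k) = x k + \<alpha> k *\<^sub>R d k \<and>
      \<mu> k \<in> unit_simplex \<and>
      \<theta>lo \<le> \<theta> k \<and> \<theta> k \<le> \<theta>hi \<and>
      (\<forall>j. B (Suc k) j =
        bfgs_update (B k j) (x (Suc k) - x k) (gamma_vec F (x k) (x (Suc k)) (\<mu> k) (\<theta> k) j)))"

end

theory Submission
  imports Defs
begin

text \<open>
  The steepest descent direction is the negative of the point of least norm in the convex hull of
  the gradients (\<open>steepest_descent_dir_min_norm\<close>). So if the liminf were positive, every convex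
  combination of the gradients would eventually have norm at least some \<open>\<epsilon> > 0\<close>. The regularization
  \<open>r\<^sub>j\<close> in the definition of \<open>\<gamma>\<^sub>j\<close> then gives a uniform curvature bound
  \<open>\<gamma>\<^sub>j \<bullet> s \<ge> a (s \<bullet> s)\<close> even without convexity of the objectives. With the Lipschitz
  condition and the boundedness of the gradients on the level set it also gives
  \<open>\<gamma>\<^sub>j \<bullet> \<gamma>\<^sub>j \<le> K (\<gamma>\<^sub>j \<bullet> s)\<close> (\<open>gamma_vec_bounds\<close>).

  Under these two bounds the potential \<open>trace B - ln \<bar>det B\<bar>\<close> of Byrd and Nocedal changes in a BFGS
  update by at most a constant plus \<open>ln (cos\<^sup>2)\<close>, where \<open>cos\<close> is the cosine of the angle between
  \<open>s\<close> and \<open>B s\<close> (\<open>trace_log_det_bfgs_update\<close>), and it is bounded below on all positive definite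
  matrices. Summing the potentials of the \<open>m\<close> matrices, one sees that at infinitely many iterations
  all \<open>m\<close> cosines are at least a fixed \<open>c > 0\<close> (\<open>bfgs_cosines_frequently_bounded\<close>):
  otherwise the sum would decrease by at least one in every late iteration. Taking one potential for
  all matrices is what makes the good iterations common to all objectives, without counting.

  At a good iteration the multipliers of the quasi-Newton subproblem turn the bounds on the cosines
  into
  \<open>- max_dir_deriv F x d / norm d \<ge> (c/2) norm (steepest_descent_dir F x) \<ge> (c/2) \<epsilon>\<close>
  (\<open>qn_direction_slope\<close>). The Wolfe conditions, on the other hand, force
  \<open>max_dir_deriv F x d / norm d\<close> to tend to zero along the iteration, in the manner of Zoutendijk
  (\<open>wolfe_slopes_tendsto_zero\<close>). This contradiction gives the liminf.

  For the consequence, the iterates stay in the compact level set, and a limit of points whose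
  steepest descent directions tend to zero is Pareto critical (\<open>pareto_critical_limit\<close>).
\<close>

section \<open>Convex hulls of finite families\<close>

text \<open>
  The weights are indexed by the family rather than by its set of values, so that members which
  coincide keep separate multipliers.
\<close>

lemma convex_hull_range:
  fixes f :: "'m::finite \<Rightarrow> 'a::real_vector"
  shows "convex hull (range f) = (\<lambda>l::real^'m. \<Sum>j\<in>UNIV. l $ j *\<^sub>R f j) ` unit_simplex"
proof (rule antisym)
  have "convex (unit_simplex :: (real^'m) set)"
  proof (rule convexI)
    fix x y :: "real^'m" and u v :: real
    assume "x \<in> unit_simplex" "y \<in> unit_simplex" "0 \<le> u" "0 \<le> v" "u + v = 1"
    then show "u *\<^sub>R x + v *\<^sub>R y \<in> unit_simplex"
      by (simp add: unit_simplex_def sum.distrib flip: sum_distrib_left)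
  qed
  moreover have "linear (\<lambda>l::real^'m. \<Sum>j\<in>UNIV. l $ j *\<^sub>R f j)"
    by (rule linearI) (simp_all add: scaleR_add_left sum.distrib scaleR_sum_right)
  ultimately have "convex ((\<lambda>l::real^'m. \<Sum>j\<in>UNIV. l $ j *\<^sub>R f j) ` unit_simplex)"
    by (rule convex_linear_image[rotated])
  moreover have "range f \<subseteq> (\<lambda>l::real^'m. \<Sum>j\<in>UNIV. l $ j *\<^sub>R f j) ` unit_simplex"
  proof
    fix y assume "y \<in> range f"
    then obtain i where i: "y = f i" by auto
    have "(\<Sum>j\<in>UNIV. (axis i 1 :: real^'m) $ j *\<^sub>R f j) = (\<Sum>j\<in>UNIV. if j = i then f j else 0)"
      by (rule sum.cong) (auto simp: axis_def)
    then have "y = (\<Sum>j\<in>UNIV. (axis i 1 :: real^'m) $ j *\<^sub>R f j)"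
      by (simp add: i)
    moreover have "(axis i 1 :: real^'m) \<in> unit_simplex"
      by (auto simp: unit_simplex_def axis_def)
    ultimately show "y \<in> (\<lambda>l::real^'m. \<Sum>j\<in>UNIV. l $ j *\<^sub>R f j) ` unit_simplex"
      by blast
  qed
  ultimately show "convex hull (range f) \<subseteq> (\<lambda>l::real^'m. \<Sum>j\<in>UNIV. l $ j *\<^sub>R f j) ` unit_simplex"
    by (simp add: hull_minimal)
  show "(\<lambda>l::real^'m. \<Sum>j\<in>UNIV. l $ j *\<^sub>R f j) ` unit_simplex \<subseteq> convex hull (range f)"
  proof clarify
    fix l :: "real^'m" assume "l \<in> unit_simplex"
    then show "(\<Sum>j\<in>UNIV. l $ j *\<^sub>R f j) \<in> convex hull (range f)"
      by (intro convex_sum convex_convex_hull) (auto simp: unit_simplex_def intro: hull_inc)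
  qed
qed

text \<open>
  The projection of the origin onto a closed convex set \<open>S\<close> satisfies the variational inequality
  \<open>p \<bullet> (q - p) \<ge> 0\<close> for all \<open>q \<in> S\<close>. It serves twice: for the gradients it yields the steepest
  descent direction, and in the product with \<open>\<real>\<close> it yields the multipliers of the quasi-Newton subproblem.
\<close>

lemma convex_hull_range_min_norm:
  fixes f :: "'m::finite \<Rightarrow> 'a::euclidean_space"
  obtains p where "p \<in> convex hull (range f)"
    and "\<And>q. q \<in> convex hull (range f) \<Longrightarrow> p \<bullet> p \<le> p \<bullet> q"
proof
  let ?S = "convex hull (range f)"
  have cl: "closed ?S" by (simp add: compact_imp_closed finite_imp_compact_convex_hull)
  show "closest_point ?S 0 \<in> ?S" using cl by (intro closest_point_in_set) auto
  show "closest_point ?S 0 \<bullet> closest_point ?S 0 \<le> closest_point ?S 0 \<bullet> q" if "q \<in> ?S" for q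
    using closest_point_dot[OF convex_convex_hull cl that, of 0]
    by (simp add: inner_diff_right)
qed

lemma Max_range_less_iff:
  fixes f :: "'m::finite \<Rightarrow> real"
  shows "Max (range f) < c \<longleftrightarrow> (\<forall>j. f j < c)"
  by (subst Max_less_iff) auto

lemma Max_range_le_iff:
  fixes f :: "'m::finite \<Rightarrow> real"
  shows "Max (range f) \<le> c \<longleftrightarrow> (\<forall>j. f j \<le> c)"
  by (subst Max_le_iff) auto

lemma unit_simplex_weighted_le:
  fixes l :: "real^'m"
  assumes "l \<in> unit_simplex" "\<And>j. f j \<le> c"
  shows "(\<Sum>j\<in>UNIV. l $ j * f j) \<le> c"
proof -
  have "(\<Sum>j\<in>UNIV. l $ j * f j) \<le> (\<Sum>j\<in>UNIV. l $ j * c)"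
    using assms by (intro sum_mono mult_left_mono) (auto simp: unit_simplex_def)
  also have "\<dots> = c"
    using assms(1) by (simp add: unit_simplex_def flip: sum_distrib_right)
  finally show ?thesis .
qed

section \<open>Steepest descent and Pareto criticality\<close>

lemma convex_hull_gradients_inner_le:
  fixes F :: "real^'n \<Rightarrow> real^'m"
  assumes "q \<in> convex hull (range (\<lambda>j. comp_grad F j x))"
  shows "q \<bullet> d \<le> max_dir_deriv F x d"
proof -
  obtain l :: "real^'m" where l: "l \<in> unit_simplex" "q = (\<Sum>j\<in>UNIV. l $ j *\<^sub>R comp_grad F j x)"
    using assms by (auto simp: convex_hull_range)
  have "q \<bullet> d = (\<Sum>j\<in>UNIV. l $ j * (comp_grad F j x \<bullet> d))"
    by (simp add: l(2) inner_sum_left)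
  also have "\<dots> \<le> max_dir_deriv F x d"
    by (rule unit_simplex_weighted_le[OF l(1)]) (simp add: max_dir_deriv_def)
  finally show ?thesis .
qed

lemma zero_notin_convex_hull_gradients:
  assumes "\<not> pareto_critical F x"
  shows "0 \<notin> convex hull (range (\<lambda>j. comp_grad F j x))"
proof
  assume 0: "0 \<in> convex hull (range (\<lambda>j. comp_grad F j x))"
  obtain d where "\<forall>j. comp_grad F j x \<bullet> d < 0"
    using assms by (auto simp: pareto_critical_def)
  then have "max_dir_deriv F x d < 0" by (simp add: max_dir_deriv_def Max_range_less_iff)
  with convex_hull_gradients_inner_le[OF 0, of d] show False by simp
qed

text \<open>
  Let \<open>p\<close> be the point of least norm in the hull of the gradients. Its being in the hull bounds the
  objective below by \<open>p \<bullet> d + (norm d)\<^sup>2 / 2 = (norm (d + p))\<^sup>2 / 2 - (p \<bullet> p) / 2\<close>, and the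
  variational inequality shows that \<open>d = - p\<close> attains the value \<open>- (p \<bullet> p) / 2\<close>. Existence,
  uniqueness and the value of the minimizer all follow at once.
\<close>

lemma steepest_descent_dir_min_norm:
  fixes F :: "real^'n \<Rightarrow> real^'m"
  shows "- steepest_descent_dir F x \<in> convex hull (range (\<lambda>j. comp_grad F j x))" (is "?in")
    and "q \<in> convex hull (range (\<lambda>j. comp_grad F j x)) \<Longrightarrow>
          norm (steepest_descent_dir F x) \<le> norm q"
proof -
  let ?S = "convex hull (range (\<lambda>j. comp_grad F j x))"
  let ?m = "\<lambda>d. max_dir_deriv F x d + (1/2) * (norm d)\<^sup>2"
  obtain p where p: "p \<in> ?S" "\<And>q. q \<in> ?S \<Longrightarrow> p \<bullet> p \<le> p \<bullet> q"
    using convex_hull_range_min_norm[of "\<lambda>j. comp_grad F j x"] by blast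
  have low: "?m d \<ge> (1/2) * (norm (d + p))\<^sup>2 - (1/2) * (p \<bullet> p)" for d
  proof -
    have "p \<bullet> d \<le> max_dir_deriv F x d" by (rule convex_hull_gradients_inner_le[OF p(1)])
    moreover have "(norm (d + p))\<^sup>2 = (norm d)\<^sup>2 + 2 * (p \<bullet> d) + p \<bullet> p"
      by (simp add: power2_norm_eq_inner inner_add_left inner_add_right inner_commute)
    ultimately show ?thesis by linarith
  qed
  have up: "?m (- p) \<le> - (1/2) * (p \<bullet> p)"
  proof -
    have "max_dir_deriv F x (- p) \<le> - (p \<bullet> p)"
      unfolding max_dir_deriv_def Max_range_le_iff
    proof
      fix j
      have "p \<bullet> p \<le> p \<bullet> comp_grad F j x" by (rule p(2)) (auto intro: hull_inc)
      then show "comp_grad F j x \<bullet> - p \<le> - (p \<bullet> p)" by (simp add: inner_commute)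
    qed
    then show ?thesis by (simp add: power2_norm_eq_inner)
  qed
  have "steepest_descent_dir F x = - p"
    unfolding steepest_descent_dir_def
  proof (rule the_equality)
    have "?m (- p) \<le> ?m d" for d
      using low[of d] up zero_le_power2[of "norm (d + p)"] by linarith
    then show "is_arg_min ?m (\<lambda>_. True) (- p)"
      by (simp add: is_arg_min_linorder)
    fix d assume "is_arg_min ?m (\<lambda>_. True) d"
    then have "?m d \<le> ?m (- p)" unfolding is_arg_min_linorder by blast
    then have "(norm (d + p))\<^sup>2 \<le> 0"
      using low[of d] up by linarith
    then show "d = - p" by (simp add: eq_neg_iff_add_eq_0)
  qed
  note eq = this
  show ?in using p(1) by (simp add: eq)
  assume q: "q \<in> ?S"
  have "norm p * norm p \<le> norm p * norm q"
    using p(2)[OF q] norm_cauchy_schwarz[of p q]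
    by (simp add: power2_norm_eq_inner flip: power2_eq_square)
  then have "norm p \<le> norm q" by (cases "p = 0") auto
  then show "norm (steepest_descent_dir F x) \<le> norm q" by (simp add: eq)
qed

text \<open>
  If \<open>d\<close> were a common descent direction at the limit, the directional derivatives along \<open>d\<close> would
  stay below a negative constant near it; then so would \<open>q \<bullet> d\<close> for every \<open>q\<close> in the hull of the
  gradients, in particular for the negated steepest descent directions, which tend to zero.
\<close>

lemma pareto_critical_limit:
  fixes F :: "real^'n \<Rightarrow> real^'m"
  assumes cont: "\<And>j. continuous_on UNIV (comp_grad F j)" and x: "x \<longlonglongrightarrow> xs"
    and sd: "(\<lambda>k. steepest_descent_dir F (x k)) \<longlonglongrightarrow> 0"
  shows "pareto_critical F xs"
  unfolding pareto_critical_def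
proof
  assume "\<exists>d. \<forall>j. comp_grad F j xs \<bullet> d < 0"
  then obtain d where d: "\<And>j. comp_grad F j xs \<bullet> d < 0" by blast
  define c where "c = max_dir_deriv F xs d"
  have c: "c < 0" using d by (simp add: c_def max_dir_deriv_def Max_range_less_iff)
  have "\<forall>\<^sub>F k in sequentially. comp_grad F j (x k) \<bullet> d < c / 2" for j
  proof (rule order_tendstoD(2))
    have "isCont (comp_grad F j) xs"
      using cont by (simp add: continuous_on_eq_continuous_at)
    then show "(\<lambda>k. comp_grad F j (x k) \<bullet> d) \<longlonglongrightarrow> comp_grad F j xs \<bullet> d"
      by (intro tendsto_intros isCont_tendsto_compose[OF _ x])
    have "comp_grad F j xs \<bullet> d \<le> c" by (simp add: c_def max_dir_deriv_def)
    with c show "comp_grad F j xs \<bullet> d < c / 2" by simp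
  qed
  then have "\<forall>\<^sub>F k in sequentially. \<forall>j. comp_grad F j (x k) \<bullet> d < c / 2"
    by (rule eventually_all_finite)
  moreover have "(\<lambda>k. - steepest_descent_dir F (x k) \<bullet> d) \<longlonglongrightarrow> - 0 \<bullet> d"
    by (intro tendsto_intros sd)
  then have "\<forall>\<^sub>F k in sequentially. c / 2 < - steepest_descent_dir F (x k) \<bullet> d"
    by (rule order_tendstoD(1)) (use c in simp)
  ultimately have "\<forall>\<^sub>F k in sequentially. False"
  proof eventually_elim
    case (elim k)
    then have "max_dir_deriv F (x k) d < c / 2"
      unfolding max_dir_deriv_def Max_range_less_iff by blast
    with elim(2) convex_hull_gradients_inner_le[OF steepest_descent_dir_min_norm(1), of F "x k" d]
    show False by linarith
  qed
  then show False by simp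
qed

section \<open>Multipliers of the quasi-Newton subproblem\<close>

text \<open>
  Optimality conditions for a finite maximum of convex quadratics \<open>\<phi>\<^sub>j\<close>, with value \<open>T\<close> at \<open>d\<close>.
  Pairing each gradient of \<open>\<phi>\<^sub>j\<close> at \<open>d\<close> with the slack \<open>T - \<phi>\<^sub>j d\<close> encodes stationarity and
  complementarity as one condition, that zero lies in the convex hull of these pairs, and spares the
  distinction between active and inactive indices. If zero is not in the hull, the projection
  \<open>(u, w)\<close> of the origin has a positive inner product with all pairs, and a short step along \<open>- u\<close>
  decreases every \<open>\<phi>\<^sub>j\<close> below \<open>T\<close>.
\<close>

lemma qn_model_multipliers:
  fixes F :: "real^'n \<Rightarrow> real^'m"
  assumes min: "is_arg_min (qn_model F x B) (\<lambda>_. True) d"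
    and sym: "\<And>j. transpose (B j) = B j"
  obtains l where "l \<in> unit_simplex"
    and "(\<Sum>j\<in>UNIV. l $ j *\<^sub>R (comp_grad F j x + B j *v d)) = 0"
    and "(\<Sum>j\<in>UNIV. l $ j * (comp_grad F j x \<bullet> d + (1/2) * (d \<bullet> (B j *v d)))) = qn_model F x B d"
proof -
  define T where "T = qn_model F x B d"
  define \<phi> where "\<phi> = (\<lambda>j e. comp_grad F j x \<bullet> e + (1/2) * (e \<bullet> (B j *v e)))"
  let ?z = "\<lambda>j. (comp_grad F j x + B j *v d, T - \<phi> j d)"
  have T_ge: "\<phi> j d \<le> T" for j
    by (simp add: T_def qn_model_def \<phi>_def)
  obtain p where p: "p \<in> convex hull (range ?z)"
      "\<And>q. q \<in> convex hull (range ?z) \<Longrightarrow> p \<bullet> p \<le> p \<bullet> q"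
    using convex_hull_range_min_norm[of ?z] by blast
  obtain u w where uw: "p = (u, w)" by fastforce
  have "p = 0"
  proof (rule ccontr)
    assume "p \<noteq> 0"
    define P where "P = p \<bullet> p"
    have P: "P > 0" using \<open>p \<noteq> 0\<close> by (simp add: P_def)
    define K where "K = (\<Sum>j\<in>UNIV. \<bar>u \<bullet> (B j *v u)\<bar>)"
    have K: "u \<bullet> (B j *v u) \<le> K" for j
      unfolding K_def by (rule order_trans[OF abs_ge_self]) (rule member_le_sum, auto)
    have K0: "K \<ge> 0" by (simp add: K_def sum_nonneg)
    \<comment> \<open>the first bound keeps the slack terms nonnegative, the second controls the quadratic terms\<close>
    define t where "t = min (1 / (\<bar>w\<bar> + 1)) (P / (K + 1))"
    have t: "t > 0" using P K0 by (simp add: t_def)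
    have "t * w \<le> t * (\<bar>w\<bar> + 1)" using t by (intro mult_left_mono) auto
    moreover have "t \<le> 1 / (\<bar>w\<bar> + 1)" by (simp add: t_def)
    then have "t * (\<bar>w\<bar> + 1) \<le> 1" by (simp add: pos_le_divide_eq)
    ultimately have tw: "t * w \<le> 1" by linarith
    have "t * K \<le> t * (K + 1)" using t by (intro mult_left_mono) auto
    moreover have "t \<le> P / (K + 1)" by (simp add: t_def)
    then have "t * (K + 1) \<le> P" using K0 by (simp add: pos_le_divide_eq)
    ultimately have tK: "t * K \<le> P" by linarith
    have "\<phi> j (d - t *\<^sub>R u) < T" for j
    proof -
      have "?z j \<in> convex hull (range ?z)" by (rule hull_inc) auto
      from p(2)[OF this] have *: "P \<le> u \<bullet> (comp_grad F j x + B j *v d) + w * (T - \<phi> j d)"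
        unfolding P_def by (simp add: uw)
      have "d \<bullet> (B j *v u) = u \<bullet> (B j *v d)"
        by (metis sym dot_lmul_matrix inner_commute vector_transpose_matrix)
      then have "\<phi> j (d - t *\<^sub>R u) = \<phi> j d - t * (u \<bullet> (comp_grad F j x + B j *v d))
          + (1/2) * (t * (t * (u \<bullet> (B j *v u))))"
        unfolding \<phi>_def by (simp add: matrix_vector_mult_diff_distrib matrix_vector_mult_scaleR
            inner_diff_left inner_diff_right inner_add_right inner_commute algebra_simps)
      also have "\<dots> \<le> \<phi> j d - t * (P - w * (T - \<phi> j d)) + (1/2) * (t * P)"
      proof -
        have "t * (P - w * (T - \<phi> j d)) \<le> t * (u \<bullet> (comp_grad F j x + B j *v d))"
          using t * by (intro mult_left_mono) auto
        moreover have "t * (u \<bullet> (B j *v u)) \<le> t * K"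
          using t K[of j] by (intro mult_left_mono) auto
        with tK have "t * (t * (u \<bullet> (B j *v u))) \<le> t * P"
          using t by (intro mult_left_mono) linarith+
        ultimately show ?thesis by linarith
      qed
      also have "\<dots> = T - (T - \<phi> j d) * (1 - t * w) - t * P / 2"
        by (simp add: algebra_simps)
      also have "\<dots> < T"
      proof -
        have "0 \<le> (T - \<phi> j d) * (1 - t * w)" using T_ge[of j] tw by simp
        moreover have "0 < t * P" using t P by simp
        ultimately show ?thesis by linarith
      qed
      finally show ?thesis .
    qed
    then have "qn_model F x B (d - t *\<^sub>R u) < T"
      unfolding qn_model_def Max_range_less_iff \<phi>_def by blast
    moreover have "T \<le> qn_model F x B (d - t *\<^sub>R u)"
      using min by (simp add: is_arg_min_linorder T_def)
    ultimately show False by simp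
  qed
  then obtain l :: "real^'m" where l: "l \<in> unit_simplex" "(\<Sum>j\<in>UNIV. l $ j *\<^sub>R ?z j) = 0"
    using p(1) by (auto simp: convex_hull_range)
  from arg_cong[OF l(2), of fst] arg_cong[OF l(2), of snd] have "(\<Sum>j\<in>UNIV. l $ j *\<^sub>R (comp_grad F j x + B j *v d)) = 0"
    and "(\<Sum>j\<in>UNIV. l $ j * (T - \<phi> j d)) = 0"
    by (simp_all add: fst_sum snd_sum)
  moreover from this(2) have "(\<Sum>j\<in>UNIV. l $ j * \<phi> j d) = T"
    using l(1) by (simp add: unit_simplex_def right_diff_distrib sum_subtractf flip: sum_distrib_right)
  ultimately show ?thesis
    using that l(1) by (simp add: \<phi>_def T_def)
qed

text \<open>
  Stationarity gives \<open>(\<Sum>j. l\<^sub>j g\<^sub>j) \<bullet> d = - (\<Sum>j. l\<^sub>j (d \<bullet> B\<^sub>j d))\<close> for the gradients \<open>g\<^sub>j\<close>, so by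
  complementarity the optimal value is half of this quantity. It dominates the maximal directional
  derivative because the quadratic terms are nonnegative.
\<close>

lemma qn_direction_multipliers:
  fixes F :: "real^'n \<Rightarrow> real^'m"
  assumes min: "is_arg_min (qn_model F x B) (\<lambda>_. True) d"
    and pd: "\<And>j. sym_pos_def (B j)"
  obtains l where "l \<in> unit_simplex"
    and "(\<Sum>j\<in>UNIV. l $ j *\<^sub>R comp_grad F j x) = - (\<Sum>j\<in>UNIV. l $ j *\<^sub>R (B j *v d))"
    and "max_dir_deriv F x d \<le> - (1/2) * (\<Sum>j\<in>UNIV. l $ j * (d \<bullet> (B j *v d)))"
proof -
  have sym: "transpose (B j) = B j" for j using pd by (simp add: sym_pos_def_def)
  obtain l where l: "l \<in> unit_simplex"
    "(\<Sum>j\<in>UNIV. l $ j *\<^sub>R (comp_grad F j x + B j *v d)) = 0"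
    "(\<Sum>j\<in>UNIV. l $ j * (comp_grad F j x \<bullet> d + (1/2) * (d \<bullet> (B j *v d)))) = qn_model F x B d"
    by (rule qn_model_multipliers[OF min sym])
  define G where "G = (\<Sum>j\<in>UNIV. l $ j *\<^sub>R comp_grad F j x)"
  have G: "G = - (\<Sum>j\<in>UNIV. l $ j *\<^sub>R (B j *v d))"
    using l(2) by (simp add: G_def scaleR_add_right sum.distrib eq_neg_iff_add_eq_0)
  have "G \<bullet> d = - (\<Sum>j\<in>UNIV. l $ j * (d \<bullet> (B j *v d)))"
    by (simp add: G inner_sum_left inner_commute[of _ d] inner_sum_right)
  moreover have "qn_model F x B d = G \<bullet> d + (1/2) * (\<Sum>j\<in>UNIV. l $ j * (d \<bullet> (B j *v d)))"
    unfolding l(3)[symmetric] G_def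
    by (simp add: inner_sum_left sum_distrib_left distrib_left sum.distrib mult_ac)
  ultimately have model: "qn_model F x B d = - (1/2) * (\<Sum>j\<in>UNIV. l $ j * (d \<bullet> (B j *v d)))"
    by simp
  have "max_dir_deriv F x d \<le> qn_model F x B d"
    unfolding max_dir_deriv_def Max_range_le_iff
  proof
    fix j
    have "0 \<le> d \<bullet> (B j *v d)" using pd[of j] by (cases "d = 0") (auto simp: sym_pos_def_def less_imp_le)
    then have "comp_grad F j x \<bullet> d \<le> comp_grad F j x \<bullet> d + (1/2) * (d \<bullet> (B j *v d))" by simp
    also have "\<dots> \<le> qn_model F x B d" by (simp add: qn_model_def)
    finally show "comp_grad F j x \<bullet> d \<le> qn_model F x B d" .
  qed
  with model G that[OF l(1)] show ?thesis by (simp add: G_def)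
qed

lemma qn_direction_descent:
  fixes F :: "real^'n \<Rightarrow> real^'m"
  assumes min: "is_arg_min (qn_model F x B) (\<lambda>_. True) d"
    and pd: "\<And>j. sym_pos_def (B j)"
    and "\<not> pareto_critical F x"
  shows "max_dir_deriv F x d < 0"
proof -
  obtain l where l: "l \<in> unit_simplex"
    "(\<Sum>j\<in>UNIV. l $ j *\<^sub>R comp_grad F j x) = - (\<Sum>j\<in>UNIV. l $ j *\<^sub>R (B j *v d))"
    "max_dir_deriv F x d \<le> - (1/2) * (\<Sum>j\<in>UNIV. l $ j * (d \<bullet> (B j *v d)))"
    using qn_direction_multipliers[OF min pd] by blast
  have "(\<Sum>j\<in>UNIV. l $ j *\<^sub>R comp_grad F j x) \<in> convex hull (range (\<lambda>j. comp_grad F j x))"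
    unfolding convex_hull_range using l(1) by blast
  with zero_notin_convex_hull_gradients[OF assms(3)] have "d \<noteq> 0" using l(2) by auto
  then have pos: "d \<bullet> (B j *v d) > 0" for j using pd[of j] by (simp add: sym_pos_def_def)
  \<comment> \<open>the maximum over the indices separates the weighted average from zero\<close>
  have "(\<Sum>j\<in>UNIV. l $ j * - (d \<bullet> (B j *v d))) \<le> Max (range (\<lambda>j. - (d \<bullet> (B j *v d))))"
    by (rule unit_simplex_weighted_le[OF l(1)]) simp
  also have "\<dots> < 0" unfolding Max_range_less_iff using pos by simp
  finally show ?thesis using l(3) by (simp add: sum_negf)
qed

text \<open>
  The multipliers express a convex combination of the gradients as \<open>- (\<Sum>j. l\<^sub>j B\<^sub>j d)\<close>. Its norm is
  at least that of the steepest descent direction, and at most \<open>\<Sum>j. l\<^sub>j norm (B\<^sub>j d)\<close>, which the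
  bound \<open>c\<close> on the cosines compares with \<open>\<Sum>j. l\<^sub>j (d \<bullet> B\<^sub>j d)\<close>.
\<close>

lemma qn_direction_slope:
  fixes F :: "real^'n \<Rightarrow> real^'m"
  assumes min: "is_arg_min (qn_model F x B) (\<lambda>_. True) d"
    and pd: "\<And>j. sym_pos_def (B j)"
    and c: "c \<ge> 0" "\<And>j. c * (norm d * norm (B j *v d)) \<le> d \<bullet> (B j *v d)"
  shows "max_dir_deriv F x d \<le> - (c/2) * norm d * norm (steepest_descent_dir F x)"
proof -
  obtain l where l: "l \<in> unit_simplex"
    "(\<Sum>j\<in>UNIV. l $ j *\<^sub>R comp_grad F j x) = - (\<Sum>j\<in>UNIV. l $ j *\<^sub>R (B j *v d))"
    "max_dir_deriv F x d \<le> - (1/2) * (\<Sum>j\<in>UNIV. l $ j * (d \<bullet> (B j *v d)))"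
    using qn_direction_multipliers[OF min pd] by blast
  have l0: "0 \<le> l $ j" for j using l(1) by (simp add: unit_simplex_def)
  have "(\<Sum>j\<in>UNIV. l $ j *\<^sub>R comp_grad F j x) \<in> convex hull (range (\<lambda>j. comp_grad F j x))"
    unfolding convex_hull_range using l(1) by blast
  then have "norm (steepest_descent_dir F x) \<le> norm (\<Sum>j\<in>UNIV. l $ j *\<^sub>R comp_grad F j x)"
    by (rule steepest_descent_dir_min_norm)
  also have "\<dots> \<le> (\<Sum>j\<in>UNIV. l $ j * norm (B j *v d))"
    unfolding l(2) norm_minus_cancel by (rule sum_norm_le) (simp add: l0)
  finally have "c * norm d * norm (steepest_descent_dir F x)
      \<le> c * norm d * (\<Sum>j\<in>UNIV. l $ j * norm (B j *v d))"
    by (rule mult_left_mono) (simp add: c(1))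
  also have "\<dots> = (\<Sum>j\<in>UNIV. l $ j * (c * (norm d * norm (B j *v d))))"
    by (simp add: sum_distrib_left mult_ac)
  also have "\<dots> \<le> (\<Sum>j\<in>UNIV. l $ j * (d \<bullet> (B j *v d)))"
    by (intro sum_mono mult_left_mono c(2) l0)
  finally show ?thesis using l(3) by (simp add: field_simps)
qed

section \<open>The BFGS update as a congruence\<close>

lemma outer_prod_mult_vec: "outer_prod v w *v u = (w \<bullet> u) *\<^sub>R v"
  by (simp add: outer_prod_def matrix_vector_mult_def vec_eq_iff inner_vec_def sum_distrib_right
      sum_distrib_left mult_ac)

lemma mult_outer_prod: "A ** outer_prod v w = outer_prod (A *v v) w"
  by (simp add: outer_prod_def matrix_matrix_mult_def matrix_vector_mult_def vec_eq_iff
      sum_distrib_right mult.assoc)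

lemma outer_prod_mult: "outer_prod v w ** A = outer_prod v (transpose A *v w)"
  by (simp add: outer_prod_def matrix_matrix_mult_def matrix_vector_mult_def vec_eq_iff
      transpose_def sum_distrib_left mult_ac)

lemma transpose_outer_prod: "transpose (outer_prod v w) = outer_prod w v"
  by (simp add: outer_prod_def transpose_def vec_eq_iff mult.commute)

lemma trace_outer_prod: "trace (outer_prod v w) = v \<bullet> w"
  by (simp add: outer_prod_def trace_def inner_vec_def)

lemma transpose_add: "transpose (A + B) = transpose A + transpose (B :: real^'n^'m)"
  by (simp add: transpose_def vec_eq_iff)

lemma matrix_add_rdistrib: "(A + B) ** C = A ** C + B ** (C :: real^'n^'m)"
  by (simp add: matrix_matrix_mult_def vec_eq_iff sum.distrib distrib_right)

text \<open>
  An orthogonal change of basis takes \<open>v\<close> to a multiple of a unit vector. The matrix then differs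
  from the identity in a single column only, and Cramer's rule gives its determinant.
\<close>

lemma det_mat_1_plus_outer_prod:
  fixes u v :: "real^'n"
  shows "det (mat 1 + outer_prod u v) = 1 + u \<bullet> v"
proof (cases "v = 0")
  case True
  have "outer_prod u 0 = 0" by (simp add: outer_prod_def vec_eq_iff)
  then show ?thesis by (simp add: True)
next
  case False
  obtain k :: 'n where True by simp
  obtain Q where Q: "orthogonal_matrix Q" "Q *v axis k 1 = (1 / norm v) *\<^sub>R v"
    using orthogonal_matrix_exists_basis[of "(1 / norm v) *\<^sub>R v" k] False by auto
  have QQ: "transpose Q ** Q = mat 1" "Q ** transpose Q = mat 1"
    using Q(1) by (auto simp: orthogonal_matrix_def)
  define w where "w = norm v *\<^sub>R (transpose Q *v u)"
  have v: "v = norm v *\<^sub>R (Q *v axis k 1)" using False by (simp add: Q(2))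
  have "transpose Q *v v = norm v *\<^sub>R ((transpose Q ** Q) *v axis k 1)"
    by (subst v) (simp add: matrix_vector_mult_scaleR matrix_vector_mul_assoc del: matrix_vector_mult_basis)
  then have Qv: "transpose Q *v v = norm v *\<^sub>R axis k 1" by (simp add: QQ)
  have "transpose Q ** (mat 1 + outer_prod u v) ** Q
      = mat 1 + outer_prod (transpose Q *v u) (transpose Q *v v)"
    by (simp add: matrix_add_ldistrib matrix_add_rdistrib mult_outer_prod outer_prod_mult QQ)
  also have "outer_prod (transpose Q *v u) (transpose Q *v v) = outer_prod w (axis k 1)"
    unfolding Qv w_def by (simp add: outer_prod_def vec_eq_iff)
  finally have eq: "transpose Q ** (mat 1 + outer_prod u v) ** Q = mat 1 + outer_prod w (axis k 1)" .
  have "mat 1 + outer_prod w (axis k 1)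
      = (\<chi> i j. if j = k then (mat 1 *v (axis k 1 + w)) $ i else (mat 1 :: real^'n^'n) $ i $ j)"
    unfolding matrix_vector_mul_lid by (auto simp: vec_eq_iff outer_prod_def axis_def mat_def)
  then have "det (mat 1 + outer_prod w (axis k 1)) = 1 + w $ k"
    by (simp only: cramer_lemma) simp
  also have "w $ k = u \<bullet> v"
  proof -
    have "w $ k = norm v * ((transpose Q *v u) \<bullet> axis k 1)" by (simp add: w_def inner_axis)
    also have "\<dots> = u \<bullet> (norm v *\<^sub>R (Q *v axis k 1))"
      by (metis dot_lmul_matrix inner_scaleR_right transpose_matrix_vector)
    finally show ?thesis using v by simp
  qed
  finally have "det (transpose Q ** (mat 1 + outer_prod u v) ** Q) = 1 + u \<bullet> v" by (simp add: eq)
  moreover have "det (transpose Q) * det Q = 1" using QQ(1) by (metis det_I det_mul)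
  ultimately show ?thesis by (simp add: det_mul) (metis mult.commute mult.left_commute mult_1)
qed

text \<open>
  The update is a congruence by a rank-one perturbation \<open>M\<close> of the identity. Expanding with
  \<open>\<tau> = s \<bullet> B s\<close>, \<open>b = B s\<close> and \<open>M = 1 + s v\<^sup>T\<close> gives
  \<open>B + v b\<^sup>T + b v\<^sup>T + \<tau> v v\<^sup>T = B - b b\<^sup>T / \<tau> + \<tau> (v + b / \<tau>) (v + b / \<tau>)\<^sup>T\<close>, and \<open>v\<close> is chosen so
  that \<open>v + b / \<tau>\<close> is the multiple of \<open>\<gamma>\<close> that completes the square. Positive definiteness and the
  determinant of the update both follow from this form.
\<close>

lemma bfgs_update_congruence:
  fixes B :: "real^'n^'n" and s \<gamma> :: "real^'n"
  assumes sym: "transpose B = B" and pos: "0 < s \<bullet> (B *v s)" "0 < \<gamma> \<bullet> s"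
  obtains M where "bfgs_update B s \<gamma> = transpose M ** B ** M"
    and "det M = sqrt ((\<gamma> \<bullet> s) / (s \<bullet> (B *v s)))"
proof
  define \<tau> g b r where "\<tau> = s \<bullet> (B *v s)" "g = \<gamma> \<bullet> s" "b = B *v s" "r = sqrt (\<tau> * g)"
  note defs = this
  define v where "v = (1 / r) *\<^sub>R \<gamma> - (1 / \<tau>) *\<^sub>R b"
  define M where "M = mat 1 + outer_prod s v"
  have tg: "\<tau> > 0" "g > 0" using pos by (simp_all add: defs)
  then have r: "r > 0" "r * r = \<tau> * g" by (simp_all add: defs)
  have "transpose M = mat 1 + outer_prod v s"
    by (simp add: M_def transpose_add transpose_outer_prod transpose_mat)
  then have "transpose M ** B = B + outer_prod v b"
    by (simp add: matrix_add_rdistrib outer_prod_mult sym defs)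
  then have "transpose M ** B ** M = B + outer_prod v b + (outer_prod b v + \<tau> *\<^sub>R outer_prod v v)"
    unfolding M_def
    by (simp add: matrix_add_ldistrib matrix_vector_mult_add_rdistrib mult_outer_prod outer_prod_mult_vec)
      (simp add: defs outer_prod_def vec_eq_iff inner_commute algebra_simps)
  also have "\<dots> = B - outer_prod b b /\<^sub>R \<tau> + outer_prod \<gamma> \<gamma> /\<^sub>R g"
  proof -
    have *: "v $ i * b $ j + (b $ i * v $ j + \<tau> * (v $ i * v $ j))
        = \<gamma> $ i * \<gamma> $ j / g - b $ i * b $ j / \<tau>" for i j
    proof -
      have "\<tau> * ((\<gamma> $ i / r) * (\<gamma> $ j / r)) = \<tau> * (\<gamma> $ i * \<gamma> $ j) / (r * r)" by simp
      also have "\<dots> = \<gamma> $ i * \<gamma> $ j / g" using tg by (simp add: r(2))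
      finally have 1: "\<tau> * ((\<gamma> $ i / r) * (\<gamma> $ j / r)) = \<gamma> $ i * \<gamma> $ j / g" .
      have vi: "v $ i = \<gamma> $ i / r - b $ i / \<tau>" for i by (simp add: v_def)
      have "(p - x / \<tau>) * y + (x * (q - y / \<tau>) + \<tau> * ((p - x / \<tau>) * (q - y / \<tau>)))
          = \<tau> * (p * q) - x * y / \<tau>" for p q x y
        using tg by (simp add: field_simps)
      then show ?thesis unfolding 1[symmetric] vi .
    qed
    show ?thesis
      using * by (simp add: vec_eq_iff outer_prod_def divide_inverse algebra_simps)
  qed
  also have "\<dots> = bfgs_update B s \<gamma>"
    by (simp add: bfgs_update_def mult_outer_prod outer_prod_mult sym defs)
  finally show "bfgs_update B s \<gamma> = transpose M ** B ** M" by simp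
  have "g = r * sqrt (g / \<tau>)"
    using tg by (simp add: defs(4) real_sqrt_mult real_sqrt_divide)
  moreover have "s \<bullet> v = g / r - 1"
    using tg by (simp add: v_def inner_diff_right inner_commute defs)
  ultimately have "r * (1 + s \<bullet> v) = r * sqrt (g / \<tau>)" using r by (simp add: distrib_left)
  then have "1 + s \<bullet> v = sqrt (g / \<tau>)" using r by simp
  then show "det M = sqrt ((\<gamma> \<bullet> s) / (s \<bullet> (B *v s)))"
    unfolding M_def det_mat_1_plus_outer_prod defs .
qed

lemma det_bfgs_update:
  fixes B :: "real^'n^'n"
  assumes sym: "transpose B = B" and pos: "0 < s \<bullet> (B *v s)" "0 < \<gamma> \<bullet> s"
  shows "det (bfgs_update B s \<gamma>) = det B * ((\<gamma> \<bullet> s) / (s \<bullet> (B *v s)))"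
proof -
  obtain M where "bfgs_update B s \<gamma> = transpose M ** B ** M"
    and "det M = sqrt ((\<gamma> \<bullet> s) / (s \<bullet> (B *v s)))"
    using bfgs_update_congruence[OF assms] .
  moreover from this(2) have "det M * det M = (\<gamma> \<bullet> s) / (s \<bullet> (B *v s))" using pos by simp
  ultimately show ?thesis by (simp add: det_mul mult_ac)
qed

lemma sym_pos_def_bfgs_update:
  fixes B :: "real^'n^'n"
  assumes pd: "sym_pos_def B" and "s \<noteq> 0" "0 < \<gamma> \<bullet> s"
  shows "sym_pos_def (bfgs_update B s \<gamma>)"
proof -
  have sym: "transpose B = B" and pos: "0 < s \<bullet> (B *v s)"
    using assms by (auto simp: sym_pos_def_def)
  obtain M where M: "bfgs_update B s \<gamma> = transpose M ** B ** M"
      "det M = sqrt ((\<gamma> \<bullet> s) / (s \<bullet> (B *v s)))"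
    using bfgs_update_congruence[OF sym pos assms(3)] .
  then have "det M \<noteq> 0" using pos assms(3) by simp
  then have inv: "invertible M" by (simp add: invertible_det_nz)
  show ?thesis
    unfolding sym_pos_def_def
  proof (intro conjI allI impI)
    show "transpose (bfgs_update B s \<gamma>) = bfgs_update B s \<gamma>"
      by (simp add: M(1) matrix_transpose_mul sym matrix_mul_assoc)
    fix v :: "real^'n" assume "v \<noteq> 0"
    then have "M *v v \<noteq> 0"
      using inv by (metis matrix_left_invertible_ker invertible_left_inverse)
    then have "0 < (M *v v) \<bullet> (B *v (M *v v))"
      using pd by (simp add: sym_pos_def_def)
    also have "\<dots> = v \<bullet> (bfgs_update B s \<gamma> *v v)"
      unfolding M(1)
      by (metis dot_lmul_matrix inner_commute matrix_vector_mul_assoc transpose_matrix_vector)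
    finally show "0 < v \<bullet> (bfgs_update B s \<gamma> *v v)" .
  qed
qed

lemma det_nonzero_sym_pos_def:
  assumes "sym_pos_def B" shows "det B \<noteq> 0"
proof -
  have "\<forall>v. B *v v = 0 \<longrightarrow> v = 0"
    using assms unfolding sym_pos_def_def by (metis inner_zero_right less_irrefl)
  then show ?thesis
    by (metis invertible_det_nz invertible_left_inverse matrix_left_invertible_ker)
qed

section \<open>The trace-determinant potential\<close>

text \<open>
  The absolute value keeps the logarithm meaningful when the determinant is only known to be
  nonzero.
\<close>

definition trace_log_det :: "real^'n^'n \<Rightarrow> real"
  where "trace_log_det B = trace B - ln \<bar>det B\<bar>"

text \<open>
  Let \<open>\<beta> = B s \<bullet> B s\<close>, \<open>\<tau> = s \<bullet> B s\<close>, \<open>\<nu> = s \<bullet> s\<close> and \<open>g = \<gamma> \<bullet> s\<close>. The trace changes by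
  \<open>(\<gamma> \<bullet> \<gamma>) / g - \<beta> / \<tau>\<close> and the determinant is multiplied by \<open>g / \<tau>\<close>. With \<open>cos\<^sup>2 = \<tau>\<^sup>2 / (\<nu> \<beta>)\<close>
  one has \<open>\<tau> / g = cos\<^sup>2 (\<beta> / \<tau>) / (g / \<nu>)\<close>, and the term \<open>ln (\<beta> / \<tau>)\<close> that this produces is
  absorbed by \<open>- \<beta> / \<tau>\<close> because \<open>ln t \<le> t - 1\<close>.
\<close>

lemma trace_log_det_bfgs_update:
  fixes B :: "real^'n^'n" and s \<gamma> :: "real^'n"
  assumes pd: "sym_pos_def B" and s: "s \<noteq> 0" and a: "0 < a"
    and curv: "a * (s \<bullet> s) \<le> \<gamma> \<bullet> s" and size: "\<gamma> \<bullet> \<gamma> \<le> K * (\<gamma> \<bullet> s)"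
  shows "trace_log_det (bfgs_update B s \<gamma>) \<le> trace_log_det B + (K - ln a - 1)
    + ln ((s \<bullet> (B *v s))\<^sup>2 / ((s \<bullet> s) * ((B *v s) \<bullet> (B *v s))))"
proof -
  define \<tau> g \<beta> \<nu> where "\<tau> = s \<bullet> (B *v s)" "g = \<gamma> \<bullet> s"
    "\<beta> = (B *v s) \<bullet> (B *v s)" "\<nu> = s \<bullet> s"
  note defs = this
  have sym: "transpose B = B" and \<tau>: "\<tau> > 0" using pd s by (auto simp: sym_pos_def_def defs)
  have \<nu>: "\<nu> > 0" using s by (simp add: defs)
  have "a * \<nu> \<le> g" using curv by (simp add: defs)
  with mult_pos_pos[OF a \<nu>] \<nu> have g: "g > 0" "a \<le> g / \<nu>"
    by (simp_all add: pos_le_divide_eq)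
  have "B *v s \<noteq> 0" using \<tau> by (auto simp: defs)
  then have \<beta>: "\<beta> > 0" by (simp add: defs)
  have "trace (bfgs_update B s \<gamma>) = trace B - \<beta> / \<tau> + (\<gamma> \<bullet> \<gamma>) / g"
  proof -
    have "trace (bfgs_update B s \<gamma>)
        = trace B - trace (outer_prod (B *v s) (B *v s) /\<^sub>R \<tau>) + trace (outer_prod \<gamma> \<gamma> /\<^sub>R g)"
      by (simp add: bfgs_update_def mult_outer_prod outer_prod_mult sym trace_add trace_sub defs)
    moreover have "trace (c *\<^sub>R A) = c * trace A" for c and A :: "real^'n^'n"
      by (simp add: trace_def sum_distrib_left)
    ultimately show ?thesis by (simp add: trace_outer_prod divide_inverse defs mult_ac)
  qed
  moreover have "(\<gamma> \<bullet> \<gamma>) / g \<le> K" using size g by (simp add: field_simps defs)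
  moreover have "ln \<bar>det (bfgs_update B s \<gamma>)\<bar> = ln \<bar>det B\<bar> + ln (g / \<tau>)"
  proof -
    have "det (bfgs_update B s \<gamma>) = det B * (g / \<tau>)"
      using det_bfgs_update[OF sym] \<tau> g by (simp add: defs)
    then have "\<bar>det (bfgs_update B s \<gamma>)\<bar> = \<bar>det B\<bar> * (g / \<tau>)"
      using \<tau> g by (simp add: abs_mult)
    moreover have "0 < \<bar>det B\<bar>" "0 < g / \<tau>"
      using det_nonzero_sym_pos_def[OF pd] \<tau> g by simp_all
    ultimately show ?thesis by (simp only: ln_mult_pos)
  qed
  moreover have "ln (g / \<tau>) = ln (g / \<nu>) - ln (\<tau>\<^sup>2 / (\<nu> * \<beta>)) - ln (\<beta> / \<tau>)"
    using \<tau> g \<nu> \<beta> by (simp add: ln_div ln_mult power2_eq_square)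
  moreover have "ln a \<le> ln (g / \<nu>)" using g a by simp
  moreover have "ln (\<beta> / \<tau>) \<le> \<beta> / \<tau> - 1" using \<beta> \<tau> by (intro ln_le_minus_one) simp
  ultimately show ?thesis unfolding trace_log_det_def defs(1,3,4)[symmetric] by linarith
qed

text \<open>
  The entries of a positive definite matrix are bounded by its trace, so the Leibniz formula gives
  \<open>\<bar>det B\<bar> \<le> n! (trace B)\<^sup>n\<close>. This crude bound suffices since the logarithm of the right-hand side
  grows more slowly than the trace.
\<close>

lemma trace_log_det_bounded_below:
  obtains C where "\<And>B :: real^'n^'n. sym_pos_def B \<Longrightarrow> C \<le> trace_log_det B"
proof
  let ?n = "CARD('n)"
  fix B :: "real^'n^'n" assume pd: "sym_pos_def B"
  have sym: "B $ i $ j = B $ j $ i" for i j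
    using pd unfolding sym_pos_def_def by (metis transpose_def vec_lambda_beta)
  \<comment> \<open>\<open>c = 0\<close> gives the diagonal entries, \<open>c = 1\<close> and \<open>c = - 1\<close> bound the others by them\<close>
  have quad: "(axis i 1 + c *\<^sub>R axis j 1) \<bullet> (B *v (axis i 1 + c *\<^sub>R axis j 1))
      = B $ i $ i + 2 * c * B $ i $ j + c\<^sup>2 * B $ j $ j" for i j c
    by (simp add: matrix_vector_right_distrib matrix_vector_mult_scaleR inner_add_left
        inner_add_right inner_axis' matrix_vector_mult_basis column_def sym[of j i] power2_eq_square algebra_simps)
  have nonneg: "0 \<le> v \<bullet> (B *v v)" for v
    using pd by (cases "v = 0") (auto simp: sym_pos_def_def less_imp_le)
  have diag: "0 < B $ i $ i" for i
  proof -
    have "axis i (1::real) \<noteq> 0" by (simp add: axis_eq_0_iff)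
    then have "0 < axis i 1 \<bullet> (B *v axis i 1)"
      using pd unfolding sym_pos_def_def by blast
    with quad[of i 0 i] show ?thesis by simp
  qed
  have diag_le: "B $ i $ i \<le> trace B" for i
    unfolding trace_def by (rule member_le_sum) (auto intro: less_imp_le diag)
  have entry: "\<bar>B $ i $ j\<bar> \<le> trace B" for i j
    using nonneg[of "axis i 1 + 1 *\<^sub>R axis j 1"] nonneg[of "axis i 1 + (-1) *\<^sub>R axis j 1"]
      diag_le[of i] diag_le[of j] unfolding quad by simp
  have tr: "0 < trace B" unfolding trace_def by (rule sum_pos) (auto simp: diag)
  have "\<bar>det B\<bar> \<le> (\<Sum>p\<in>{p. p permutes (UNIV :: 'n set)}. \<bar>of_int (sign p) * (\<Prod>i\<in>UNIV. B $ i $ p i)\<bar>)"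
    unfolding det_def by (rule sum_abs)
  also have "\<dots> \<le> (\<Sum>p\<in>{p. p permutes (UNIV :: 'n set)}. trace B ^ ?n)"
  proof (rule sum_mono)
    fix p :: "'n \<Rightarrow> 'n"
    have "\<bar>of_int (sign p) * (\<Prod>i\<in>UNIV. B $ i $ p i)\<bar> = (\<Prod>i\<in>UNIV. \<bar>B $ i $ p i\<bar>)"
      by (simp add: abs_mult abs_prod flip: of_int_abs)
    also have "\<dots> \<le> (\<Prod>i\<in>(UNIV::'n set). trace B)"
      by (rule prod_mono) (simp add: entry)
    finally show "\<bar>of_int (sign p) * (\<Prod>i\<in>UNIV. B $ i $ p i)\<bar> \<le> trace B ^ ?n" by simp
  qed
  also have "\<dots> = fact ?n * trace B ^ ?n"
    by (simp add: card_permutations)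
  finally have "ln \<bar>det B\<bar> \<le> ln (fact ?n * trace B ^ ?n)"
    using det_nonzero_sym_pos_def[OF pd] by simp
  also have "\<dots> = ln (fact ?n) + ?n * ln (trace B)"
    using tr by (simp add: ln_mult ln_realpow)
  also have "?n * ln (trace B) \<le> trace B + ?n * ln ?n"
  proof -
    have "ln (trace B / ?n) \<le> trace B / ?n - 1" using tr by (intro ln_le_minus_one) simp
    then have "?n * (ln (trace B) - ln ?n) \<le> ?n * (trace B / ?n - 1)"
      using tr by (intro mult_left_mono) (simp_all add: ln_div)
    then show ?thesis by (simp add: right_diff_distrib)
  qed
  finally show "- (ln (fact ?n) + ?n * ln ?n) \<le> trace_log_det B"
    unfolding trace_log_det_def by linarith
qed

text \<open>
  If at some iteration one of the matrices has a cosine below \<open>c\<close>, its potential receives a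
  contribution \<open>ln (cos\<^sup>2) \<le> - M\<close> while all other contributions of this kind are nonpositive. The
  threshold \<open>M\<close> is one more than the largest total increase \<open>m K'\<close> from the remaining terms, so the
  sum of the potentials drops by one. This cannot happen at all late iterations.
\<close>

lemma bfgs_cosines_frequently_bounded:
  fixes B :: "nat \<Rightarrow> 'm::finite \<Rightarrow> real^'n^'n" and s :: "nat \<Rightarrow> real^'n" and \<gamma> :: "nat \<Rightarrow> 'm \<Rightarrow> real^'n"
  assumes pd: "\<And>k j. sym_pos_def (B k j)"
    and step: "\<And>k j. B (Suc k) j = bfgs_update (B k j) (s k) (\<gamma> k j)"
    and s: "\<And>k. s k \<noteq> 0" and a: "0 < a"
    and curv: "\<And>k j. k \<ge> start \<Longrightarrow> a * (s k \<bullet> s k) \<le> \<gamma> k j \<bullet> s k"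
    and size: "\<And>k j. k \<ge> start \<Longrightarrow> \<gamma> k j \<bullet> \<gamma> k j \<le> K * (\<gamma> k j \<bullet> s k)"
  obtains c where "c > 0"
    and "\<exists>\<^sub>F k in sequentially. \<forall>j. c * (norm (s k) * norm (B k j *v s k)) \<le> s k \<bullet> (B k j *v s k)"
proof
  define K' where "K' = K - ln a - 1"
  define M where "M = CARD('m) * K' + 1"
  define c where "c = exp (- M / 2)"
  show "c > 0" by (simp add: c_def)
  define Q where "Q k j = (s k \<bullet> (B k j *v s k))\<^sup>2 /
      ((s k \<bullet> s k) * ((B k j *v s k) \<bullet> (B k j *v s k)))" for k j
  have curvB: "s k \<bullet> (B k j *v s k) > 0" for k j
    using pd[of k j] s by (simp add: sym_pos_def_def)
  then have Bs: "B k j *v s k \<noteq> 0" for k j by (metis inner_zero_right less_irrefl)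
  have Q_pos: "0 < Q k j" for k j
    using curvB[of k j] s Bs by (simp add: Q_def)
  have Q_sq: "Q k j = (s k \<bullet> (B k j *v s k) / (norm (s k) * norm (B k j *v s k)))\<^sup>2" for k j
    by (simp add: Q_def power_divide power_mult_distrib power2_norm_eq_inner)
  have Q_le: "Q k j \<le> 1" for k j
    unfolding Q_sq using curvB[of k j] s Bs
    by (intro power_le_one) (auto simp: divide_le_eq_1_pos norm_cauchy_schwarz)
  define \<Psi> where "\<Psi> k = (\<Sum>j\<in>UNIV. trace_log_det (B k j))" for k
  show "\<exists>\<^sub>F k in sequentially. \<forall>j. c * (norm (s k) * norm (B k j *v s k)) \<le> s k \<bullet> (B k j *v s k)"
  proof (rule ccontr)
    assume "\<not> ?thesis"
    then obtain k1 where k1: "\<And>k. k \<ge> k1 \<Longrightarrow>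
        \<exists>j. s k \<bullet> (B k j *v s k) < c * (norm (s k) * norm (B k j *v s k))"
      unfolding frequently_def eventually_sequentially not_not not_all not_le by blast
    have decr: "\<Psi> (Suc k) \<le> \<Psi> k - 1" if k: "k \<ge> start" "k \<ge> k1" for k
    proof -
      obtain i where "s k \<bullet> (B k i *v s k) < c * (norm (s k) * norm (B k i *v s k))"
        using k1[OF k(2)] by blast
      then have "s k \<bullet> (B k i *v s k) / (norm (s k) * norm (B k i *v s k)) \<le> c"
        using s Bs by (simp add: pos_divide_le_eq)
      then have "Q k i \<le> c\<^sup>2"
        unfolding Q_sq using curvB[of k i] by (intro power_mono) auto
      also have "\<dots> = exp (- M)" by (simp add: c_def flip: exp_of_nat_mult)
      finally have Qi: "ln (Q k i) \<le> - M" using Q_pos[of k i] by (metis ln_exp ln_mono)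
      have "(\<Sum>j\<in>UNIV. ln (Q k j)) = ln (Q k i) + (\<Sum>j\<in>UNIV - {i}. ln (Q k j))"
        by (simp add: sum.remove)
      also have "\<dots> \<le> - M"
        using Qi sum_nonpos[of "UNIV - {i}" "\<lambda>j. ln (Q k j)"] Q_le Q_pos by (simp add: ln_le_zero_iff)
      finally have Qs: "(\<Sum>j\<in>UNIV. ln (Q k j)) \<le> - M" .
      have "\<Psi> (Suc k) \<le> (\<Sum>j\<in>UNIV. trace_log_det (B k j) + K' + ln (Q k j))"
        unfolding \<Psi>_def step K'_def Q_def
        by (intro sum_mono trace_log_det_bfgs_update pd s a curv size k(1))
      also have "\<dots> = \<Psi> k + CARD('m) * K' + (\<Sum>j\<in>UNIV. ln (Q k j))"
        by (simp add: sum.distrib \<Psi>_def)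
      finally show ?thesis using Qs by (simp add: M_def)
    qed
    define k2 where "k2 = max start k1"
    have lin: "\<Psi> (k2 + n) \<le> \<Psi> k2 - n" for n
    proof (induction n)
      case (Suc n)
      have "\<Psi> (Suc (k2 + n)) \<le> \<Psi> (k2 + n) - 1" by (rule decr) (auto simp: k2_def)
      with Suc show ?case by simp
    qed simp
    obtain C where C: "\<And>A :: real^'n^'n. sym_pos_def A \<Longrightarrow> C \<le> trace_log_det A"
      by (rule trace_log_det_bounded_below) blast
    have low: "CARD('m) * C \<le> \<Psi> k" for k
      using sum_bounded_below[of UNIV C "\<lambda>j. trace_log_det (B k j)"] C pd by (simp add: \<Psi>_def)
    obtain n :: nat where "\<Psi> k2 - CARD('m) * C < n" using reals_Archimedean2 by blast
    with lin[of n] low[of "k2 + n"] show False by linarith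
  qed
qed

section \<open>Curvature of the regularized updates\<close>

text \<open>
  The term \<open>max (- \<eta>) 0\<close> in the regularization offsets any negative curvature \<open>y \<bullet> s = \<eta> (s \<bullet> s)\<close>,
  which leaves at least the contribution of \<open>\<theta> * G\<close>. Since \<open>\<bar>\<eta>\<bar> \<le> L\<close> by the Lipschitz condition,
  the correction costs at most a further \<open>L\<close> in the norm.
\<close>

lemma gamma_vec_bounds:
  fixes F :: "real^'n \<Rightarrow> real^'m"
    and \<mu> :: "real^'m"
  assumes x': "x' \<noteq> x" and \<theta>: "0 \<le> \<theta>"
  defines "G \<equiv> norm (\<Sum>i\<in>UNIV. \<mu> $ i *\<^sub>R comp_grad F i x)"
  shows "\<theta> * G * ((x' - x) \<bullet> (x' - x)) \<le> gamma_vec F x x' \<mu> \<theta> j \<bullet> (x' - x)"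
    and "norm (comp_grad F j x' - comp_grad F j x) \<le> L * norm (x' - x) \<Longrightarrow>
      gamma_vec F x x' \<mu> \<theta> j \<bullet> gamma_vec F x x' \<mu> \<theta> j
        \<le> (2 * L + \<theta> * G)\<^sup>2 * ((x' - x) \<bullet> (x' - x))"
proof -
  define s y where "s = x' - x" "y = comp_grad F j x' - comp_grad F j x"
  note defs = this
  define \<eta> where "\<eta> = (y \<bullet> s) / (norm s)\<^sup>2"
  define r where "r = max (- \<eta>) 0 + \<theta> * G"
  have \<gamma>: "gamma_vec F x x' \<mu> \<theta> j = y + r *\<^sub>R s"
    by (simp add: gamma_vec_def Let_def r_def \<eta>_def G_def defs)
  have s: "s \<noteq> 0" using x' by (simp add: defs)
  have G: "0 \<le> \<theta> * G" using \<theta> by (simp add: G_def)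
  have "(\<theta> * G - \<eta>) * (s \<bullet> s) \<le> r * (s \<bullet> s)"
    by (intro mult_right_mono) (auto simp: r_def)
  moreover have "\<eta> * (s \<bullet> s) = y \<bullet> s" using s by (simp add: \<eta>_def power2_norm_eq_inner)
  ultimately show "\<theta> * G * ((x' - x) \<bullet> (x' - x)) \<le> gamma_vec F x x' \<mu> \<theta> j \<bullet> (x' - x)"
    unfolding \<gamma> defs(1)[symmetric] by (simp add: inner_add_left left_diff_distrib)
  assume "norm (comp_grad F j x' - comp_grad F j x) \<le> L * norm (x' - x)"
  then have y: "norm y \<le> L * norm s" by (simp add: defs)
  have "\<bar>y \<bullet> s\<bar> \<le> norm y * norm s" by (rule Cauchy_Schwarz_ineq2)
  also have "\<dots> \<le> L * (norm s)\<^sup>2"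
    using mult_right_mono[OF y, of "norm s"] by (simp add: power2_eq_square mult.assoc)
  finally have "\<bar>\<eta>\<bar> \<le> L" using s by (simp add: \<eta>_def pos_divide_le_eq)
  then have r: "0 \<le> r" "r \<le> L + \<theta> * G" using G by (auto simp: r_def)
  have "norm (y + r *\<^sub>R s) \<le> norm y + r * norm s"
    using norm_triangle_ineq[of y "r *\<^sub>R s"] r(1) by simp
  also have "\<dots> \<le> (2 * L + \<theta> * G) * norm s"
    using y mult_right_mono[OF r(2), of "norm s"] by (simp add: distrib_right)
  finally have "(norm (y + r *\<^sub>R s))\<^sup>2 \<le> ((2 * L + \<theta> * G) * norm s)\<^sup>2"
    by (intro power_mono) auto
  then show "gamma_vec F x x' \<mu> \<theta> j \<bullet> gamma_vec F x x' \<mu> \<theta> j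
        \<le> (2 * L + \<theta> * G)\<^sup>2 * ((x' - x) \<bullet> (x' - x))"
    unfolding \<gamma> defs(1)[symmetric] by (simp add: power2_norm_eq_inner power_mult_distrib)
qed

section \<open>Slopes along Wolfe steps\<close>

text \<open>
  The curvature condition and the Lipschitz condition bound the step size below by
  \<open>(1 - \<sigma>) (- D) / (L (d \<bullet> d))\<close>, where \<open>D\<close> is the maximal directional derivative; sufficient
  decrease then turns this into a decrease of every objective.
\<close>

lemma wolfe_step_decrease:
  fixes F :: "real^'n \<Rightarrow> real^'m"
  assumes wolfe: "wolfe_step F \<rho> \<sigma> x d \<alpha>" and descent: "max_dir_deriv F x d < 0"
    and lip: "\<And>j. norm (comp_grad F j (x + \<alpha> *\<^sub>R d) - comp_grad F j x) \<le> L * norm (\<alpha> *\<^sub>R d)"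
    and "0 < L" "0 \<le> \<rho>"
  shows "\<rho> * (1 - \<sigma>) / L * (max_dir_deriv F x d / norm d)\<^sup>2 \<le> F x $ j - F (x + \<alpha> *\<^sub>R d) $ j"
proof -
  define D where "D = max_dir_deriv F x d"
  have \<alpha>: "\<alpha> > 0" using wolfe by (simp add: wolfe_step_def)
  have "d \<noteq> 0" using descent by (auto simp: max_dir_deriv_def)
  then have dd: "d \<bullet> d > 0" by simp
  have "max_dir_deriv F (x + \<alpha> *\<^sub>R d) d \<le> D + L * \<alpha> * (d \<bullet> d)"
    unfolding max_dir_deriv_def Max_range_le_iff
  proof
    fix j
    have "(comp_grad F j (x + \<alpha> *\<^sub>R d) - comp_grad F j x) \<bullet> d
        \<le> norm (comp_grad F j (x + \<alpha> *\<^sub>R d) - comp_grad F j x) * norm d"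
      by (rule norm_cauchy_schwarz)
    also have "\<dots> \<le> L * norm (\<alpha> *\<^sub>R d) * norm d"
      by (intro mult_right_mono lip) simp
    also have "\<dots> = L * \<alpha> * (d \<bullet> d)"
      using \<alpha> by (simp add: power2_eq_square flip: power2_norm_eq_inner)
    finally have "(comp_grad F j (x + \<alpha> *\<^sub>R d) - comp_grad F j x) \<bullet> d \<le> L * \<alpha> * (d \<bullet> d)" .
    moreover have "comp_grad F j x \<bullet> d \<le> D" by (simp add: D_def max_dir_deriv_def)
    ultimately show "comp_grad F j (x + \<alpha> *\<^sub>R d) \<bullet> d \<le> D + L * \<alpha> * (d \<bullet> d)"
      by (simp add: inner_diff_left)
  qed
  moreover have "\<sigma> * D \<le> max_dir_deriv F (x + \<alpha> *\<^sub>R d) d"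
    using wolfe by (simp add: wolfe_step_def D_def)
  ultimately have "(1 - \<sigma>) * - D \<le> \<alpha> * (L * (d \<bullet> d))" by (simp add: algebra_simps)
  moreover have "0 < L * (d \<bullet> d)" using dd \<open>0 < L\<close> by simp
  ultimately have "(1 - \<sigma>) * - D / (L * (d \<bullet> d)) \<le> \<alpha>"
    by (rule iffD2[OF pos_divide_le_eq, rotated])
  then have "\<rho> * ((1 - \<sigma>) * - D / (L * (d \<bullet> d))) * - D \<le> \<rho> * \<alpha> * - D"
    using \<open>0 \<le> \<rho>\<close> descent by (intro mult_right_mono mult_left_mono) (auto simp: D_def)
  also have "\<dots> \<le> F x $ j - F (x + \<alpha> *\<^sub>R d) $ j"
  proof -
    have "F (x + \<alpha> *\<^sub>R d) $ j \<le> F x $ j + \<rho> * \<alpha> * D"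
      using wolfe by (simp add: wolfe_step_def D_def)
    then show ?thesis by simp
  qed
  finally show ?thesis
    by (simp add: D_def power2_eq_square power_divide flip: power2_norm_eq_inner)
qed

text \<open>
  Any one objective decreases along the iterates and is bounded below on the compact set, so its
  successive differences tend to zero; up to a constant factor they dominate the squared slopes.
\<close>

lemma wolfe_slopes_tendsto_zero:
  fixes F :: "real^'n \<Rightarrow> real^'m"
  assumes cont: "continuous_on UNIV F" and cpt: "compact S" and xS: "\<And>k. x k \<in> S"
    and step: "\<And>k. x (Suc k) = x k + \<alpha> k *\<^sub>R d k"
    and wolfe: "\<And>k. wolfe_step F \<rho> \<sigma> (x k) (d k) (\<alpha> k)"
    and descent: "\<And>k. max_dir_deriv F (x k) (d k) < 0"
    and lip: "\<And>u v j. u \<in> S \<Longrightarrow> v \<in> S \<Longrightarrow> norm (comp_grad F j u - comp_grad F j v) \<le> L * norm (u - v)"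
    and L: "0 < L" and \<rho>: "0 < \<rho>" and \<sigma>: "\<sigma> < 1"
  shows "(\<lambda>k. max_dir_deriv F (x k) (d k) / norm (d k)) \<longlonglongrightarrow> 0"
proof -
  obtain j :: 'm where True by simp
  define f where "f k = F (x k) $ j" for k
  define C where "C = \<rho> * (1 - \<sigma>) / L"
  have C: "C > 0" using L \<rho> \<sigma> by (simp add: C_def)
  have decr: "C * (max_dir_deriv F (x k) (d k) / norm (d k))\<^sup>2 \<le> f k - f (Suc k)" for k
    unfolding f_def C_def step
  proof (rule wolfe_step_decrease[OF wolfe descent])
    show "norm (comp_grad F i (x k + \<alpha> k *\<^sub>R d k) - comp_grad F i (x k)) \<le> L * norm (\<alpha> k *\<^sub>R d k)" for i
      using lip[OF xS[of "Suc k"] xS[of k], of i] by (simp add: step)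
  qed (use L \<rho> in auto)
  have "decseq f"
  proof (rule decseq_SucI)
    fix k
    have "0 \<le> C * (max_dir_deriv F (x k) (d k) / norm (d k))\<^sup>2" using C by simp
    with decr[of k] show "f (Suc k) \<le> f k" by linarith
  qed
  moreover have "\<exists>b. \<forall>k. b \<le> f k"
  proof -
    have "compact ((\<lambda>z. F z $ j) ` S)"
      by (intro compact_continuous_image continuous_on_component continuous_on_subset[OF cont] cpt) auto
    then have "bdd_below ((\<lambda>z. F z $ j) ` S)"
      by (intro bounded_imp_bdd_below compact_imp_bounded)
    then show ?thesis using xS by (auto simp: bdd_below_def f_def)
  qed
  ultimately obtain l where l: "f \<longlonglongrightarrow> l" using decseq_convergent by metis
  have "(\<lambda>k. (f k - f (Suc k)) / C) \<longlonglongrightarrow> (l - l) / C"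
    using C by (intro tendsto_intros l LIMSEQ_Suc) auto
  then have lim: "(\<lambda>k. (f k - f (Suc k)) / C) \<longlonglongrightarrow> 0" by simp
  have "(\<lambda>k. (max_dir_deriv F (x k) (d k) / norm (d k))\<^sup>2) \<longlonglongrightarrow> 0"
    by (rule tendsto_sandwich[OF _ _ tendsto_const lim])
      (use decr C in \<open>auto simp: pos_le_divide_eq mult.commute\<close>)
  then show ?thesis by simp
qed

section \<open>Convergence of the method\<close>

theorem theorem3p5:
  fixes F :: "real^'n \<Rightarrow> real^'m"
    and x0 :: "real^'n"
    and N :: "(real^'n) set"
    and L \<rho> \<sigma> \<theta>lo \<theta>hi :: real
    and x d :: "nat \<Rightarrow> real^'n"
    and B :: "nat \<Rightarrow> 'm \<Rightarrow> real^'n^'n"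
    and \<alpha> \<theta> :: "nat \<Rightarrow> real"
    and \<mu> :: "nat \<Rightarrow> real^'m"
  assumes C1: "continuously_differentiable F"
    and bounded_level: "bounded (level_set F x0)"
    and N: "open N" "level_set F x0 \<subseteq> N"
    and L: "L > 0"
      "\<forall>u\<in>N. \<forall>v\<in>N. \<forall>j. norm (comp_grad F j u - comp_grad F j v) \<le> L * norm (u - v)"
    and rho: "0 < \<rho>" "\<rho> < 1/2"
    and sigma: "\<rho> < \<sigma>" "\<sigma> < 1"
    and theta: "0 < \<theta>lo" "\<theta>lo \<le> \<theta>hi"
    and run: "bfgs_run F \<rho> \<sigma> \<theta>lo \<theta>hi x0 x B d \<alpha> \<mu> \<theta>"
    and not_critical: "\<forall>k. \<not> pareto_critical F (x k)"
  shows "liminf (\<lambda>k. ereal (norm (steepest_descent_dir F (x k)))) = 0 \<and>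
    (\<exists>xs r. strict_mono (r :: nat \<Rightarrow> nat) \<and> (x \<circ> r) \<longlonglongrightarrow> xs \<and> pareto_critical F xs)"
proof -
  let ?D = "\<lambda>k. max_dir_deriv F (x k) (d k)"
  let ?sd = "\<lambda>k. steepest_descent_dir F (x k)"
  let ?s = "\<lambda>k. x (Suc k) - x k"
  let ?\<gamma> = "\<lambda>k. gamma_vec F (x k) (x (Suc k)) (\<mu> k) (\<theta> k)"
  let ?G = "\<lambda>k. norm (\<Sum>i\<in>UNIV. \<mu> k $ i *\<^sub>R comp_grad F i (x k))"
  let ?S = "level_set F x0"
  have x0: "x 0 = x0" and pd0: "\<And>j. sym_pos_def (B 0 j)"
    and argmin: "\<And>k. is_arg_min (qn_model F (x k) (B k)) (\<lambda>_. True) (d k)"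
    and wolfe: "\<And>k. wolfe_step F \<rho> \<sigma> (x k) (d k) (\<alpha> k)"
    and xstep: "\<And>k. x (Suc k) = x k + \<alpha> k *\<^sub>R d k"
    and \<mu>: "\<And>k. \<mu> k \<in> unit_simplex"
    and \<theta>: "\<And>k. \<theta>lo \<le> \<theta> k" "\<And>k. \<theta> k \<le> \<theta>hi"
    and Bstep: "\<And>k j. B (Suc k) j = bfgs_update (B k j) (?s k) (?\<gamma> k j)"
    using run unfolding bfgs_run_def by blast+
  have \<theta>_pos: "0 < \<theta> k" for k using theta(1) \<theta>(1)[of k] by linarith
  have hull: "(\<Sum>i\<in>UNIV. \<mu> k $ i *\<^sub>R comp_grad F i (x k)) \<in> convex hull (range (\<lambda>j. comp_grad F j (x k)))" for k
    unfolding convex_hull_range using \<mu> by blast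
  have G_pos: "0 < ?G k" for k
    using hull[of k] zero_notin_convex_hull_gradients[of F "x k"] not_critical by (metis zero_less_norm_iff)
  have alpha: "\<alpha> k > 0" for k using wolfe[of k] by (simp add: wolfe_step_def)
  have s_nz: "?s k \<noteq> 0" if "?D k < 0" for k
    using that alpha[of k] by (auto simp: xstep max_dir_deriv_def)
  \<comment> \<open>positive definiteness makes the direction one of descent, hence the step nonzero
    and the next matrix positive definite\<close>
  have pd: "sym_pos_def (B k j)" for k j
  proof (induction k arbitrary: j)
    case (Suc k)
    have "?D k < 0"
      using qn_direction_descent[OF argmin Suc] not_critical by blast
    then have s: "?s k \<noteq> 0" by (rule s_nz)
    have "0 < \<theta> k * ?G k * (?s k \<bullet> ?s k)" using \<theta>_pos G_pos s by simp
    also have "\<dots> \<le> ?\<gamma> k j \<bullet> ?s k"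
      by (rule gamma_vec_bounds(1)) (use s \<theta>_pos[of k] in auto)
    finally show ?case
      unfolding Bstep by (rule sym_pos_def_bfgs_update[OF Suc s])
  qed (rule pd0)
  have descent: "?D k < 0" for k
    using qn_direction_descent[OF argmin pd] not_critical by blast
  note s = s_nz[OF descent]

  have xS: "x k \<in> ?S" for k
  proof (induction k)
    case (Suc k)
    have "F (x (Suc k)) $ j \<le> F (x k) $ j" for j
    proof -
      have "F (x (Suc k)) $ j \<le> F (x k) $ j + \<rho> * \<alpha> k * ?D k"
        using wolfe[of k] by (simp add: wolfe_step_def xstep)
      moreover have "\<rho> * \<alpha> k * ?D k \<le> 0"
        using rho(1) alpha[of k] descent[of k] by (intro mult_nonneg_nonpos) auto
      ultimately show ?thesis by linarith
    qed
    with Suc show ?case unfolding level_set_def by (blast intro: order_trans)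
  qed (simp add: x0 level_set_def)
  have contF: "continuous_on UNIV F"
    using C1 by (auto simp: continuously_differentiable_def continuous_on_eq_continuous_at
        intro: differentiable_imp_continuous_within)
  have contG: "continuous_on UNIV (comp_grad F j)" for j
    using C1 by (simp add: continuously_differentiable_def)
  have "closed ?S"
    unfolding level_set_def
    by (intro closed_Collect_all closed_Collect_le continuous_on_component contF continuous_on_const)
  with bounded_level have cpt: "compact ?S" by (simp add: compact_eq_bounded_closed)
  have lip: "norm (comp_grad F j u - comp_grad F j v) \<le> L * norm (u - v)" if "u \<in> ?S" "v \<in> ?S" for u v j
    using that N(2) L(2) by blast

  have "\<exists>b. \<forall>z\<in>?S. norm (comp_grad F j z) \<le> b" for j
    using compact_imp_bounded[OF compact_continuous_image[OF continuous_on_subset[OF contG] cpt], of j]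
    by (auto simp: bounded_iff)
  then obtain b where b: "\<And>j z. z \<in> ?S \<Longrightarrow> norm (comp_grad F j z) \<le> b j" by metis
  define Gmax where "Gmax = Max (range b)"
  have Gmax: "?G k \<le> Gmax" for k
  proof -
    have "?G k \<le> (\<Sum>i\<in>UNIV. \<mu> k $ i * norm (comp_grad F i (x k)))"
      using \<mu>[of k] by (intro sum_norm_le) (simp add: unit_simplex_def)
    also have "\<dots> \<le> Gmax"
      by (rule unit_simplex_weighted_le[OF \<mu>], rule order_trans[OF b[OF xS]]) (simp add: Gmax_def)
    finally show ?thesis .
  qed

  have slopes: "(\<lambda>k. ?D k / norm (d k)) \<longlonglongrightarrow> 0"
    by (rule wolfe_slopes_tendsto_zero[where x = x and d = d and \<alpha> = \<alpha> and \<sigma> = \<sigma> and \<rho> = \<rho> and L = L,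
          OF contF cpt xS xstep wolfe descent lip L(1) rho(1) sigma(2)])

  have "liminf (\<lambda>k. ereal (norm (?sd k))) = 0"
  proof (rule ccontr)
    assume "liminf (\<lambda>k. ereal (norm (?sd k))) \<noteq> 0"
    moreover have "0 \<le> liminf (\<lambda>k. ereal (norm (?sd k)))"
      by (intro Liminf_bounded always_eventually) simp
    ultimately have "0 < liminf (\<lambda>k. ereal (norm (?sd k)))" by simp
    then obtain \<epsilon> where \<epsilon>: "0 < ereal \<epsilon>" "ereal \<epsilon> < liminf (\<lambda>k. ereal (norm (?sd k)))"
      using ereal_dense2 by blast
    from less_LiminfD[OF \<epsilon>(2)] obtain k0 where k0: "\<And>k. k \<ge> k0 \<Longrightarrow> \<epsilon> < norm (?sd k)"
      by (auto simp: eventually_sequentially)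
    \<comment> \<open>\<open>a\<close> and \<open>M / a\<close> are the constants of the two bounds on \<open>\<gamma>\<^sub>j\<close> that control the potential\<close>
    define a where "a = \<theta>lo * \<epsilon>"
    define M where "M = (2 * L + \<theta>hi * Gmax)\<^sup>2"
    have a: "a > 0" using \<epsilon>(1) theta(1) by (simp add: a_def)
    have curv: "a * (?s k \<bullet> ?s k) \<le> ?\<gamma> k j \<bullet> ?s k" if "k \<ge> k0" for k j
    proof -
      have "\<epsilon> \<le> ?G k"
        using k0[OF that] steepest_descent_dir_min_norm(2)[OF hull[of k]] by linarith
      then have "a \<le> \<theta> k * ?G k"
        unfolding a_def using \<theta>(1)[of k] \<epsilon>(1) \<theta>_pos[of k] by (intro mult_mono) auto
      then have "a * (?s k \<bullet> ?s k) \<le> \<theta> k * ?G k * (?s k \<bullet> ?s k)"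
        by (intro mult_right_mono) auto
      also have "\<dots> \<le> ?\<gamma> k j \<bullet> ?s k"
        by (rule gamma_vec_bounds(1)) (use s[of k] \<theta>_pos[of k] in auto)
      finally show ?thesis .
    qed
    have size: "?\<gamma> k j \<bullet> ?\<gamma> k j \<le> M / a * (?\<gamma> k j \<bullet> ?s k)" if "k \<ge> k0" for k j
    proof -
      have "?\<gamma> k j \<bullet> ?\<gamma> k j \<le> (2 * L + \<theta> k * ?G k)\<^sup>2 * (?s k \<bullet> ?s k)"
        by (rule gamma_vec_bounds(2)) (use s[of k] \<theta>_pos[of k] lip[OF xS xS] in auto)
      also have "\<dots> \<le> M * (?s k \<bullet> ?s k)"
      proof (rule mult_right_mono)
        have "\<theta> k * ?G k \<le> \<theta>hi * Gmax"
          using \<theta>(2)[of k] \<theta>_pos[of k] Gmax[of k] by (intro mult_mono) auto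
        then show "(2 * L + \<theta> k * ?G k)\<^sup>2 \<le> M"
          unfolding M_def using L(1) \<theta>_pos[of k] by (intro power_mono) auto
      qed simp
      also have "\<dots> = M / a * (a * (?s k \<bullet> ?s k))" using a by simp
      also have "\<dots> \<le> M / a * (?\<gamma> k j \<bullet> ?s k)"
        using a by (intro mult_left_mono curv that) (simp add: M_def)
      finally show ?thesis .
    qed
    obtain c where c: "c > 0"
      "\<exists>\<^sub>F k in sequentially. \<forall>j. c * (norm (?s k) * norm (B k j *v ?s k)) \<le> ?s k \<bullet> (B k j *v ?s k)"
      by (rule bfgs_cosines_frequently_bounded[where B = B and s = "?s" and \<gamma> = "?\<gamma>" and start = k0,
            OF pd Bstep s a curv size])
    have "\<forall>\<^sub>F k in sequentially. k \<ge> k0 \<and> - (c / 2 * \<epsilon>) < ?D k / norm (d k)"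
      using c(1) \<epsilon>(1) by (intro eventually_conj eventually_ge_at_top order_tendstoD(1)[OF slopes]) simp
    from frequently_ex[OF frequently_eventually_conj[OF c(2) this]] obtain k where k: "k \<ge> k0"
      "- (c / 2 * \<epsilon>) < ?D k / norm (d k)"
      "\<And>j. c * (norm (?s k) * norm (B k j *v ?s k)) \<le> ?s k \<bullet> (B k j *v ?s k)" by blast
    \<comment> \<open>cosines do not change under the positive scaling \<open>s = \<alpha> d\<close>\<close>
    have cosd: "c * (norm (d k) * norm (B k j *v d k)) \<le> d k \<bullet> (B k j *v d k)" for j
    proof -
      have "(\<alpha> k * \<alpha> k) * (c * (norm (d k) * norm (B k j *v d k))) \<le> (\<alpha> k * \<alpha> k) * (d k \<bullet> (B k j *v d k))"
        using k(3)[of j] alpha[of k] by (simp add: xstep matrix_vector_mult_scaleR mult_ac)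
      then show ?thesis using alpha[of k] by (simp add: mult_le_cancel_left)
    qed
    have d: "norm (d k) > 0" using s[of k] by (auto simp: xstep)
    have "?D k \<le> - (c / 2) * norm (d k) * norm (?sd k)"
      by (rule qn_direction_slope[OF argmin pd _ cosd]) (use c(1) in simp)
    also have "\<dots> \<le> - (c / 2) * norm (d k) * \<epsilon>"
      using k0[OF k(1)] c(1) by (intro mult_left_mono_neg) auto
    finally have "?D k / norm (d k) \<le> - (c / 2 * \<epsilon>)"
      using d by (simp add: pos_divide_le_eq mult_ac)
    with k(2) show False by simp
  qed
  moreover have "\<exists>xs r. strict_mono (r :: nat \<Rightarrow> nat) \<and> (x \<circ> r) \<longlonglongrightarrow> xs \<and> pareto_critical F xs"
    if lim0: "liminf (\<lambda>k. ereal (norm (?sd k))) = 0"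
  proof -
    obtain r1 :: "nat \<Rightarrow> nat" where r1: "strict_mono r1"
      "((\<lambda>k. ereal (norm (?sd k))) \<circ> r1) \<longlonglongrightarrow> 0"
      using liminf_subseq_lim[of "\<lambda>k. ereal (norm (?sd k))"] lim0 by auto
    from r1(2) have "(\<lambda>n. norm (?sd (r1 n))) \<longlonglongrightarrow> 0"
      by (simp only: o_def zero_ereal_def lim_ereal)
    then have sd: "(\<lambda>n. ?sd (r1 n)) \<longlonglongrightarrow> 0" by (rule tendsto_norm_zero_cancel)
    obtain xs r2 where r2: "strict_mono (r2 :: nat \<Rightarrow> nat)" "((x \<circ> r1) \<circ> r2) \<longlonglongrightarrow> xs"
      using cpt[unfolded compact_def, rule_format, of "x \<circ> r1"] xS by auto
    have "pareto_critical F xs"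
      by (rule pareto_critical_limit[OF contG r2(2)])
        (use LIMSEQ_subseq_LIMSEQ[OF sd r2(1)] in \<open>simp add: o_def\<close>)
    with r1(1) r2 show ?thesis
      by (intro exI[of _ xs] exI[of _ "r1 \<circ> r2"]) (simp add: strict_mono_o o_assoc)
  qed
  ultimately show ?thesis by blast
qed

end
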